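(* Let $m\ge 1$, let $\mathcal{P}$ be a probability distribution on $\mathbb{R}^m$ whose support is contained in a bounded subset of $\mathbb{R}^m$, and let $\mathcal{G}$ be a non-degenerate $m$-dimensional Gaussian distribution (i.e. with positive definite covariance). Then for every $\epsilon>0$ there exists a fully connected feed-forward neural network $u:\mathbb{R}^m\to\mathbb{R}$ with ReLU activations (of sufficiently large width and depth, depending on $\epsilon$) such that $$\mathcal{W}_2^2\big(\mathcal{P},\ \nabla u(\mathcal{G})\big)<\epsilon,$$ where $\nabla u(\mathcal{G})$ denotes the distribution of $\nabla u(\xi)$ for $\xi\sim\mathcal{G}$.
   Context: For probability distributions $\mathcal{P},\mathcal{Q}$ on $\mathbb{R}^m$ with finite second moment, the 2-Wasserstein distance is $\mathcal{W}_2(\mathcal{P},\mathcal{Q})=\big(\inf_{\gamma\in\Gamma(\mathcal{P},\mathcal{Q})}\int\|Z-Z'\|_2^2\,d\gamma(Z,Z')\big)^{1/2}$, where $\Gamma(\mathcal{P},\mathcal{Q})$ is the set of couplings (joint distributions of $(Z,Z')$ with marginals $\mathcal{P}$ and $\mathcal{Q}$). The map $\nabla u:\mathbb{R}^m\to\mathbb{R}^m$ is the gradient of the network $u$ (a piecewise-linear function, so $\nabla u$ is defined Lebesgue-almost everywhere, hence $\mathcal{G}$-almost surely), and $\nabla u(\mathcal{G})$ is the pushforward of $\mathcal{G}$ under $\nabla u$. *)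

theory Defs
  imports "HOL-Probability.Probability"
begin

definition relu :: "real \<Rightarrow> real" where
  "relu t = max 0 t"

fun hidden_layers ::
  "((nat \<Rightarrow> nat \<Rightarrow> real) \<times> (nat \<Rightarrow> real) \<times> nat \<times> nat) list \<Rightarrow> (nat \<Rightarrow> real) \<Rightarrow> (nat \<Rightarrow> real)"
where
  "hidden_layers [] h = h"
| "hidden_layers ((W, b, n_in, n_out) # Ls) h =
     hidden_layers Ls (\<lambda>i. if i < n_out then relu ((\<Sum>j<n_in. W i j * h j) + b i) else 0)"

definition relu_net ::
  "nat \<Rightarrow> (nat \<Rightarrow> real^'m) \<Rightarrow> (nat \<Rightarrow> real)
   \<Rightarrow> ((nat \<Rightarrow> nat \<Rightarrow> real) \<times> (nat \<Rightarrow> real) \<times> nat \<times> nat) list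
   \<Rightarrow> nat \<Rightarrow> (nat \<Rightarrow> real) \<Rightarrow> real \<Rightarrow> (real^'m::finite \<Rightarrow> real)"
where
  "relu_net n0 w0 b0 Ls N a c =
     (\<lambda>x. let h0 = (\<lambda>i. if i < n0 then relu (w0 i \<bullet> x + b0 i) else 0);
              hL = hidden_layers Ls h0
          in (\<Sum>j<N. a j * hL j) + c)"

definition is_relu_network :: "(real^'m::finite \<Rightarrow> real) \<Rightarrow> bool" where
  "is_relu_network u \<longleftrightarrow> (\<exists>n0 w0 b0 Ls N a c. u = relu_net n0 w0 b0 Ls N a c)"

section \<open>Gradient (defined where u is differentiable, 0 elsewhere -- a null set here)\<close>

definition grad :: "(real^'m::finite \<Rightarrow> real) \<Rightarrow> real^'m \<Rightarrow> real^'m" where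
  "grad u x = (if u differentiable (at x)
               then (\<chi> i. frechet_derivative u (at x) (axis i 1)) else 0)"

definition pos_def_matrix :: "real^'m^'m \<Rightarrow> bool" where
  "pos_def_matrix S \<longleftrightarrow> transpose S = S \<and> (\<forall>x. x \<noteq> 0 \<longrightarrow> x \<bullet> (S *v x) > 0)"

definition gaussian_density :: "real^'m::finite \<Rightarrow> real^'m^'m \<Rightarrow> real^'m \<Rightarrow> real" where
  "gaussian_density mu S x =
     (2 * pi) powr (- real CARD('m) / 2) * det S powr (-1/2)
     * exp (- (1/2) * ((x - mu) \<bullet> (matrix_inv S *v (x - mu))))"

definition gaussian_measure :: "real^'m::finite \<Rightarrow> real^'m^'m \<Rightarrow> (real^'m) measure" where
  "gaussian_measure mu S = density lborel (\<lambda>x. ennreal (gaussian_density mu S x))"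

definition couplings :: "'a::euclidean_space measure \<Rightarrow> 'a measure \<Rightarrow> ('a \<times> 'a) measure set" where
  "couplings P Q = {\<gamma>. sets \<gamma> = sets (borel :: ('a \<times> 'a) measure)
                       \<and> distr \<gamma> borel fst = P \<and> distr \<gamma> borel snd = Q}"

definition wasserstein2_sq :: "'a::euclidean_space measure \<Rightarrow> 'a measure \<Rightarrow> ennreal" where
  "wasserstein2_sq P Q =
     (INF \<gamma>\<in>couplings P Q. \<integral>\<^sup>+ z. ennreal ((norm (fst z - snd z))\<^sup>2) \<partial>\<gamma>)"

end

theory Submission
  imports Defs
begin

text \<open>
  Up to an error below \<open>\<epsilon>\<close>, \<open>P\<close> is replaced by its image under a map with finite range \<open>Z\<close>.
  A finitely supported law with weights \<open>p\<close> on \<open>Z\<close> is attained exactly by a maximum of affine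
  functions \<open>z \<bullet> x + b z\<close>: its gradient is \<open>z\<close> on the cell where the \<open>z\<close>-th function is the
  largest, so one needs \<open>b\<close> such that this cell has Gaussian mass \<open>p z\<close>. Such a \<open>b\<close> minimises the
  semi-discrete Kantorovich functional, the Gaussian integral of the maximum minus the sum of
  \<open>p z * b z\<close>, since the cell masses minus \<open>p\<close> are its partial derivatives. A maximum of affine
  functions is a ReLU network because \<open>max s t = t + relu (s - t)\<close>.
\<close>

section \<open>Gaussian measures\<close>

lemma det_shear:
  fixes m n :: "'n::finite"
  assumes "m \<noteq> n"
  shows "det (matrix (\<lambda>x::real^'n. \<chi> i. if i = m then x $ m + x $ n else x $ i)) = 1"
proof -
  have "matrix (\<lambda>x::real^'n. \<chi> i. if i = m then x $ m + x $ n else x $ i) =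
      (\<chi> k. if k = m then row m (mat 1) + 1 *s row n (mat 1) else row k (mat 1))"
    by (auto simp: matrix_def row_def mat_def axis_def vec_eq_iff)
  then show ?thesis
    using det_row_operation[OF assms, where c = 1 and A = "mat 1 :: real^'n^'n"] by (simp only: det_I)
qed

text \<open>The library states this for index types in class \<open>wellorder\<close>, which only
  serves to compute the determinant of a shear.\<close>

lemma lmeasurable_linear_image_cart:
  fixes f :: "real^'n::finite \<Rightarrow> real^'n"
  assumes "linear f"
  shows "\<forall>S \<in> lmeasurable. f ` S \<in> lmeasurable \<and>
    measure lebesgue (f ` S) = \<bar>det (matrix f)\<bar> * measure lebesgue S"
  using assms
proof (rule induct_linear_elementary)
  fix f g :: "real^'n \<Rightarrow> real^'n"
  assume "linear f" "linear g"
    and f: "\<forall>S \<in> lmeasurable. f ` S \<in> lmeasurable \<and>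
      measure lebesgue (f ` S) = \<bar>det (matrix f)\<bar> * measure lebesgue S"
    and g: "\<forall>S \<in> lmeasurable. g ` S \<in> lmeasurable \<and>
      measure lebesgue (g ` S) = \<bar>det (matrix g)\<bar> * measure lebesgue S"
  have "det (matrix (f \<circ> g)) = det (matrix f) * det (matrix g)"
    using \<open>linear f\<close> \<open>linear g\<close> by (simp add: matrix_compose det_mul)
  moreover have "f ` g ` S \<in> lmeasurable \<and>
      measure lebesgue (f ` g ` S) = \<bar>det (matrix f)\<bar> * (\<bar>det (matrix g)\<bar> * measure lebesgue S)"
    if "S \<in> lmeasurable" for S
    using that f g by metis
  ultimately show "\<forall>S \<in> lmeasurable. (f \<circ> g) ` S \<in> lmeasurable \<and>
      measure lebesgue ((f \<circ> g) ` S) = \<bar>det (matrix (f \<circ> g))\<bar> * measure lebesgue S"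
    by (simp only: image_comp[symmetric] abs_mult) (simp add: mult.assoc)
next
  fix f :: "real^'n \<Rightarrow> real^'n" and i
  assume f: "linear f" "\<And>x. f x $ i = 0"
  \<comment> \<open>A map with a constantly zero coordinate is not onto, hence not injective. The
    image is then negligible and the determinant is 0, so both sides vanish.\<close>
  have "axis i 1 \<noteq> f x" for x
    using f(2)[of x] by (metis axis_nth zero_neq_one)
  then have "\<not> surj f" by (metis surjD)
  then have "\<not> inj f"
    using f(1) linear_injective_imp_surjective by blast
  then have "det (matrix f) = 0" and neg: "negligible (f ` S)" for S
    using det_nz_iff_inj[OF f(1)] negligible_linear_singular_image[OF f(1)] by auto
  then show "\<forall>S \<in> lmeasurable. f ` S \<in> lmeasurable \<and>
      measure lebesgue (f ` S) = \<bar>det (matrix f)\<bar> * measure lebesgue S"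
    by (auto simp: negligible_iff_measure)
next
  fix c :: "'n \<Rightarrow> real"
  have "det (matrix (\<lambda>x. \<chi> i. c i * x $ i)) = prod c UNIV"
    by (subst det_diagonal) (auto simp: matrix_def axis_def)
  then show "\<forall>S \<in> lmeasurable. (\<lambda>x. \<chi> i. c i * x $ i) ` S \<in> lmeasurable \<and>
      measure lebesgue ((\<lambda>x. \<chi> i. c i * x $ i) ` S) =
      \<bar>det (matrix (\<lambda>x. \<chi> i. c i * x $ i))\<bar> * measure lebesgue S"
    by (simp add: measurable_stretch measure_stretch)
next
  fix m n :: 'n
  assume "m \<noteq> n"
  let ?h = "\<lambda>x::real^'n. \<chi> i. x $ Transposition.transpose m n i"
  have lin: "linear ?h"
    by (rule linearI) (simp_all add: vec_eq_iff)
  have "orthogonal_transformation ?h"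
    unfolding orthogonal_transformation
  proof (intro conjI allI lin)
    fix v :: "real^'n"
    have "(\<Sum>i\<in>UNIV. (v $ Transposition.transpose m n i)\<^sup>2) = (\<Sum>i\<in>UNIV. (v $ i)\<^sup>2)"
      using sum.permute[OF permutes_swap_id[of m UNIV n], of "\<lambda>i. (v $ i)\<^sup>2"] by (simp add: o_def)
    then show "norm (?h v) = norm v"
      by (simp add: norm_vec_def L2_set_def)
  qed
  then have det: "\<bar>det (matrix ?h)\<bar> = 1"
    by (metis abs_1 abs_minus_cancel det_orthogonal_matrix orthogonal_transformation_matrix)
  have "measure lebesgue (?h ` cbox a b) = measure lebesgue (cbox a b)" for a b
  proof (cases "cbox a b = {}")
    case False
    have eq: "?h ` cbox a b = cbox (?h a) (?h b)"
    proof (intro set_eqI iffI)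
      fix y assume "y \<in> cbox (?h a) (?h b)"
      then have y: "a $ Transposition.transpose m n i \<le> y $ i \<and> y $ i \<le> b $ Transposition.transpose m n i" for i
        by (simp add: mem_box_cart)
      have "?h y \<in> cbox a b"
        using y[of "Transposition.transpose m n _"] by (simp add: mem_box_cart)
      then show "y \<in> ?h ` cbox a b"
        by (rule rev_image_eqI) (simp add: vec_eq_iff)
    qed (auto simp: mem_box_cart)
    have "(\<Prod>i\<in>UNIV. b $ Transposition.transpose m n i - a $ Transposition.transpose m n i) =
        (\<Prod>i\<in>UNIV. b $ i - a $ i)"
      using prod.permute[OF permutes_swap_id[of m UNIV n], of "\<lambda>i. b $ i - a $ i"] by (simp add: o_def)
    moreover have "cbox (?h a) (?h b) \<noteq> {}"
      using False eq by blast
    ultimately show ?thesis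
      using False eq by (simp add: content_cbox_cart)
  qed simp
  then have "?h ` S \<in> lmeasurable \<and> 1 * measure lebesgue S = measure lebesgue (?h ` S)"
    if "S \<in> lmeasurable" for S
    by (intro measure_linear_sufficient[OF lin that]) simp
  then show "\<forall>S \<in> lmeasurable. ?h ` S \<in> lmeasurable \<and>
      measure lebesgue (?h ` S) = \<bar>det (matrix ?h)\<bar> * measure lebesgue S"
    unfolding det by metis
next
  fix m n :: 'n
  assume "m \<noteq> n"
  let ?h = "\<lambda>x::real^'n. \<chi> i. if i = m then x $ m + x $ n else x $ i"
  have lin: "linear ?h"
    by (rule linearI) (simp_all add: vec_eq_iff algebra_simps)
  have "measure lebesgue (?h ` cbox a b) = measure lebesgue (cbox a b)" for a b
  proof (cases "cbox a b = {}")
    case False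
    \<comment> \<open>\<open>measure_shear_interval\<close> wants a lower corner with nonnegative
      \<open>n\<close>-th coordinate. Shifting the box by \<open>v\<close> makes that coordinate 0,
      and translation invariance removes the shift again.\<close>
    define v :: "real^'n" where "v = (- a $ n) *\<^sub>R axis n 1"
    have "?h ` cbox (v + a) (v + b) = (+) (?h v) ` ?h ` cbox a b"
      unfolding cbox_translation by (simp add: image_image linear_add[OF lin])
    moreover have "cbox (v + a) (v + b) \<noteq> {}"
      using False by (simp add: cbox_translation)
    then have "measure lebesgue (?h ` cbox (v + a) (v + b)) = measure lebesgue (cbox (v + a) (v + b))"
      by (rule measure_shear_interval[OF \<open>m \<noteq> n\<close>]) (simp add: v_def axis_def)
    ultimately show ?thesis
      by (simp only: measure_translation) (simp only: cbox_translation measure_translation)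
  qed simp
  then have "?h ` S \<in> lmeasurable \<and> 1 * measure lebesgue S = measure lebesgue (?h ` S)"
    if "S \<in> lmeasurable" for S
    by (intro measure_linear_sufficient[OF lin that]) simp
  then show "\<forall>S \<in> lmeasurable. ?h ` S \<in> lmeasurable \<and>
      measure lebesgue (?h ` S) = \<bar>det (matrix ?h)\<bar> * measure lebesgue S"
    by (simp only: det_shear[OF \<open>m \<noteq> n\<close>] abs_one mult_1_left) (blast dest: sym)
qed

text \<open>Linear change of variables as an identity of measures, so that an integral can be
  transformed by rewriting \<open>lborel\<close>. On a box, the preimage under \<open>C\<close> is
  the image under the inverse \<open>D\<close>, of volume scaled by
  \<open>\<bar>det D\<bar>\<close>, and the two determinants multiply to 1.\<close>

lemma lborel_eq_density_linear:
  fixes C :: "real^'n::finite^'n"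
  assumes C: "invertible C"
  shows "lborel = density (distr lborel borel ((*v) C)) (\<lambda>_. ennreal \<bar>det C\<bar>)"
proof (rule lborel_eqI)
  fix l u :: "real^'n"
  assume lu: "\<And>b. b \<in> Basis \<Longrightarrow> l \<bullet> b \<le> u \<bullet> b"
  obtain D where CD: "C ** D = mat 1" "D ** C = mat 1"
    using C by (auto simp: invertible_def)
  have inv: "C *v (D *v x) = x" "D *v (C *v x) = x" for x
    by (simp_all add: matrix_vector_mul_assoc CD)
  then have vimage: "(*v) C -` box l u = (*v) D ` box l u"
    by (auto simp: inv) (metis inv(2) rev_image_eqI)
  have mv[measurable]: "(*v) C \<in> borel_measurable borel"
    by (intro borel_measurable_continuous_onI linear_continuous_on) (simp add: linear_linear)
  have "(*v) D ` box l u \<in> lmeasurable"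
    and meas: "measure lebesgue ((*v) D ` box l u) = \<bar>det D\<bar> * measure lebesgue (box l u)"
    using lmeasurable_linear_image_cart[of "(*v) D"] lmeasurable_box by auto
  then have "emeasure lebesgue ((*v) C -` box l u) = ennreal (\<bar>det D\<bar> * measure lebesgue (box l u))"
    unfolding vimage by (simp add: emeasure_eq_measure2)
  moreover have sets: "(*v) C -` box l u \<in> sets borel"
    by (rule measurable_sets_borel[OF mv]) auto
  ultimately have "emeasure lborel ((*v) C -` box l u) = ennreal (\<bar>det D\<bar> * measure lebesgue (box l u))"
    by simp
  moreover have "\<bar>det C\<bar> * \<bar>det D\<bar> = 1"
    by (metis CD(1) abs_1 abs_mult det_I det_mul)
  ultimately have "ennreal \<bar>det C\<bar> * emeasure lborel ((*v) C -` box l u) = ennreal (measure lebesgue (box l u))"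
    by (simp add: ennreal_mult[symmetric] mult.assoc[symmetric] del: measure_completion)
  then show "emeasure (density (distr lborel borel ((*v) C)) (\<lambda>_. ennreal \<bar>det C\<bar>)) (box l u) =
      ennreal (\<Prod>b\<in>Basis. (u - l) \<bullet> b)"
    using lu by (simp add: emeasure_density_const emeasure_distr measure_lborel_box_eq inner_diff_left)
qed simp

text \<open>Gram-Schmidt for the form \<open>x \<bullet> (S *v y)\<close> gives an
  \<open>S\<close>-orthonormal family. With these vectors as the columns of \<open>B\<close>,
  \<open>transpose B ** S ** B\<close> is the identity, which forces
  \<open>S ** B ** transpose B\<close> to be the identity too; hence \<open>C = S ** B\<close> is
  the required factor.\<close>

lemma pos_def_matrix_factor:
  fixes S :: "real^'n::finite^'n"
  assumes "pos_def_matrix S"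
  obtains C :: "real^'n^'n" where "invertible C" "S = C ** transpose C"
proof -
  have symm: "x \<bullet> (S *v y) = y \<bullet> (S *v x)" for x y
    using assms
    by (metis dot_lmul_matrix inner_commute pos_def_matrix_def transpose_matrix_vector)
  have "\<exists>v. \<forall>i\<in>I. \<forall>j\<in>I. v i \<bullet> (S *v v j) = (if i = j then 1 else 0)" for I :: "'n set"
    using finite[of I]
  proof (induction rule: finite_induct)
    case (insert i I)
    then obtain v where v: "\<And>j k. j \<in> I \<Longrightarrow> k \<in> I \<Longrightarrow> v j \<bullet> (S *v v k) = (if j = k then 1 else 0)"
      by blast
    let ?W = "(\<lambda>j. S *v v j) ` I"
    have "I \<subset> UNIV"
      using insert.hyps by auto
    then have "card I < CARD('n)"
      by (simp add: psubset_card_mono)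
    moreover have "dim ?W \<le> card ?W"
      by (rule dim_le_card) (auto simp: span_superset)
    moreover have "card ?W \<le> card I"
      by (rule card_image_le) simp
    ultimately have "dim ?W < DIM(real^'n)"
      by simp
    \<comment> \<open>Orthogonality to every \<open>S *v v j\<close> in the usual sense is
      \<open>S\<close>-orthogonality to every \<open>v j\<close>. Only the scaling to
      \<open>S\<close>-length 1 remains.\<close>
    from orthogonal_to_subspace_exists[OF this]
    obtain x where x: "x \<noteq> 0" "\<And>y. y \<in> span ?W \<Longrightarrow> orthogonal x y"
      by blast
    have pos: "x \<bullet> (S *v x) > 0"
      using assms x(1) by (simp add: pos_def_matrix_def)
    define y where "y = (1 / sqrt (x \<bullet> (S *v x))) *\<^sub>R x"
    have orth: "y \<bullet> (S *v v j) = 0" if "j \<in> I" for j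
      using x(2)[of "S *v v j"] that by (simp add: y_def orthogonal_def span_base)
    have "y \<bullet> (S *v y) = 1"
      using pos by (simp add: y_def matrix_vector_mult_scaleR power2_eq_square[symmetric] real_sqrt_pow2)
    then show ?case
      using orth insert.hyps v symm by (intro exI[of _ "v(i := y)"]) auto
  qed simp
  from this[of UNIV] obtain v :: "'n \<Rightarrow> real^'n" where "\<forall>i j. v i \<bullet> (S *v v j) = (if i = j then 1 else 0)"
    by auto
  then have v: "v i \<bullet> (S *v v j) = (if i = j then 1 else 0)" for i j
    by simp
  define B :: "real^'n^'n" where "B = (\<chi> k i. v i $ k)"
  have "(transpose B ** (S ** B)) $ i $ j = v i \<bullet> (S *v v j)" for i j
    by (simp add: B_def matrix_matrix_mult_def transpose_def inner_vec_def matrix_vector_mult_def)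
  then have 1: "transpose B ** (S ** B) = mat 1"
    by (simp add: vec_eq_iff v mat_def)
  then have "(B ** transpose B) ** S = mat 1"
    by (metis matrix_left_right_inverse matrix_mul_assoc)
  then have 2: "S ** (B ** transpose B) = mat 1"
    by (metis matrix_left_right_inverse)
  have "transpose S = S"
    using assms by (simp add: pos_def_matrix_def)
  then have "(S ** B) ** transpose (S ** B) = (S ** (B ** transpose B)) ** S"
    by (simp add: matrix_transpose_mul matrix_mul_assoc)
  then have "S = (S ** B) ** transpose (S ** B)"
    by (simp add: 2)
  moreover have "invertible (S ** B)"
    using 1 by (metis invertible_left_inverse)
  ultimately show thesis
    using that by blast
qed

text \<open>In the coordinates \<open>x = mu + C *v y\<close> the quadratic form becomes the squared
  norm of \<open>y\<close>, and the Jacobian \<open>\<bar>det C\<bar>\<close> cancels the factor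
  \<open>det S powr (-1/2)\<close>. What is left factorises over the coordinates.\<close>

lemma gaussian_density_affine:
  fixes C :: "real^'n::finite^'n"
  assumes C: "invertible C"
  shows "\<bar>det C\<bar> * gaussian_density mu (C ** transpose C) (mu + C *v y) =
    (\<Prod>b\<in>Basis. std_normal_density (y \<bullet> b))"
proof -
  let ?S = "C ** transpose C"
  obtain D where CD: "C ** D = mat 1" "D ** C = mat 1"
    using C by (auto simp: invertible_def)
  have tr: "transpose C ** transpose D = mat 1" "transpose D ** transpose C = mat 1"
    by (metis CD matrix_transpose_mul transpose_mat)+
  have "?S ** (transpose D ** D) = C ** ((transpose C ** transpose D) ** D)"
    by (simp only: matrix_mul_assoc)
  then have SD: "?S ** (transpose D ** D) = mat 1"
    by (simp add: tr CD)
  then have "(transpose D ** D) ** ?S = mat 1"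
    by (metis matrix_left_right_inverse)
  \<comment> \<open>\<open>matrix_inv\<close> is a choice among two-sided inverses. Exhibiting one
    shows that the chosen matrix is an inverse, and uniqueness of inverses then identifies the
    two.\<close>
  with SD have "?S ** matrix_inv ?S = mat 1 \<and> matrix_inv ?S ** ?S = mat 1"
    unfolding matrix_inv_def
    by (intro someI[of "\<lambda>A. ?S ** A = mat 1 \<and> A ** ?S = mat 1" "transpose D ** D"]) simp
  then have "transpose D ** D = (matrix_inv ?S ** ?S) ** (transpose D ** D)"
    by (metis matrix_mul_lid)
  also have "\<dots> = matrix_inv ?S ** (?S ** (transpose D ** D))"
    by (rule matrix_mul_assoc[symmetric])
  finally have inv: "matrix_inv ?S = transpose D ** D"
    by (simp only: SD matrix_mul_rid)
  have "matrix_inv ?S *v (C *v y) = transpose D *v (D *v (C *v y))"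
    unfolding inv by (simp only: matrix_vector_mul_assoc matrix_mul_assoc)
  also have "\<dots> = transpose D *v y"
    by (simp only: matrix_vector_mul_assoc[of D C y] CD matrix_vector_mul_lid)
  finally have "(C *v y) \<bullet> (matrix_inv ?S *v (C *v y)) = (C *v y) \<bullet> (transpose D *v y)"
    by simp
  also have "\<dots> = (D *v (C *v y)) \<bullet> y"
    by (metis dot_lmul_matrix inner_commute transpose_matrix_vector transpose_transpose)
  also have "\<dots> = (norm y)\<^sup>2"
    by (simp only: matrix_vector_mul_assoc CD matrix_vector_mul_lid power2_norm_eq_inner)
  finally have quad: "(C *v y) \<bullet> (matrix_inv ?S *v (C *v y)) = (norm y)\<^sup>2" .
  have "det C \<noteq> 0"
    using C invertible_det_nz by blast
  then have "det ?S powr (- 1/2) = inverse \<bar>det C\<bar>"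
    by (simp add: det_mul det_transpose powr_minus powr_half_sqrt)
  then have det: "\<bar>det C\<bar> * det ?S powr (-1/2) = 1"
    using \<open>det C \<noteq> 0\<close> by simp
  have "(\<Prod>b\<in>Basis. std_normal_density (y \<bullet> b)) =
      (\<Prod>b\<in>(Basis::(real^'n) set). 1 / sqrt (2 * pi)) * (\<Prod>b\<in>Basis. exp (- (y \<bullet> b)\<^sup>2 / 2))"
    unfolding std_normal_density_def by (rule prod.distrib)
  also have "(\<Prod>b\<in>Basis. exp (- (y \<bullet> b)\<^sup>2 / 2)) = exp (\<Sum>b\<in>Basis. - (y \<bullet> b)\<^sup>2 / 2)"
    by (simp add: exp_sum)
  also have "(\<Sum>b\<in>Basis. - (y \<bullet> b)\<^sup>2 / 2) = - (\<Sum>b\<in>Basis. (y \<bullet> b) * (y \<bullet> b)) / 2"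
    by (simp only: sum_negf sum_divide_distrib[symmetric] power2_eq_square)
  also have "(\<Sum>b\<in>Basis. (y \<bullet> b) * (y \<bullet> b)) = (norm y)\<^sup>2"
    by (simp only: power2_norm_eq_inner euclidean_inner[of y y])
  also have "(\<Prod>b\<in>(Basis::(real^'n) set). 1 / sqrt (2 * pi)) = ((2 * pi) powr (- 1 / 2)) ^ CARD('n)"
    by (simp add: powr_half_sqrt[symmetric] powr_minus_divide)
  also have "\<dots> = (2 * pi) powr (- real CARD('n) / 2)"
    by (simp add: powr_power)
  finally show ?thesis
    using det by (simp add: gaussian_density_def quad)
qed

lemma borel_measurable_gaussian_density[measurable]:
  "gaussian_density mu S \<in> borel_measurable borel"
proof -
  have "continuous_on UNIV (gaussian_density mu S)"
    unfolding gaussian_density_def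
    by (intro continuous_intros linear_continuous_on_compose[OF _ matrix_vector_mul_linear])
  then show ?thesis
    by (rule borel_measurable_continuous_onI)
qed

text \<open>The measure is given by a density formula, so its total mass has to be computed. After a
  translation by \<open>mu\<close> and the linear substitution \<open>C\<close> the integral is a
  product of one-dimensional standard normal integrals.\<close>

lemma prob_space_gaussian_measure:
  fixes mu :: "real^'n::finite" and S :: "real^'n^'n"
  assumes "pos_def_matrix S"
  shows "prob_space (gaussian_measure mu S)"
proof
  obtain C :: "real^'n^'n" where C: "invertible C" "S = C ** transpose C"
    using pos_def_matrix_factor[OF assms] .
  have [measurable]: "(*v) C \<in> borel_measurable borel"
    by (intro borel_measurable_continuous_onI linear_continuous_on) (simp add: linear_linear)
  have nonneg: "0 \<le> gaussian_density mu S x" for x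
    by (simp add: gaussian_density_def)
  have "emeasure (gaussian_measure mu S) (space (gaussian_measure mu S)) =
      (\<integral>\<^sup>+x. ennreal (gaussian_density mu S x) \<partial>lborel)"
    by (simp add: gaussian_measure_def emeasure_density)
  also have "\<dots> = (\<integral>\<^sup>+x. ennreal (gaussian_density mu S x) \<partial>distr lborel borel ((+) mu))"
    by (simp add: lborel_distr_plus)
  also have "\<dots> = (\<integral>\<^sup>+x. ennreal (gaussian_density mu S (mu + x)) \<partial>lborel)"
    by (simp add: nn_integral_distr)
  also have "\<dots> = (\<integral>\<^sup>+x. ennreal (gaussian_density mu S (mu + x))
      \<partial>density (distr lborel borel ((*v) C)) (\<lambda>_. ennreal \<bar>det C\<bar>))"
    by (subst lborel_eq_density_linear[OF C(1)]) simp
  also have "\<dots> = (\<integral>\<^sup>+y. ennreal \<bar>det C\<bar> * ennreal (gaussian_density mu S (mu + C *v y)) \<partial>lborel)"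
    by (simp add: nn_integral_density nn_integral_distr)
  also have "\<dots> = (\<integral>\<^sup>+y. (\<Prod>b\<in>(Basis::(real^'n) set). ennreal (std_normal_density (y \<bullet> b))) \<partial>lborel)"
    using gaussian_density_affine[OF C(1), of mu]
    by (simp add: ennreal_mult[symmetric] nonneg prod_ennreal C(2)[symmetric])
  also have "\<dots> = (\<Prod>b\<in>(Basis::(real^'n) set). \<integral>\<^sup>+t. ennreal (std_normal_density t) \<partial>lborel)"
    by (rule nn_integral_lborel_prod) auto
  also have "(\<integral>\<^sup>+t. ennreal (std_normal_density t) \<partial>lborel) = 1"
    by (simp add: nn_integral_eq_integral)
  finally show "emeasure (gaussian_measure mu S) (space (gaussian_measure mu S)) = 1"
    by simp
qed

text \<open>Two distinct slopes tie on a hyperplane, so this makes ties between affine pieces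
  negligible.\<close>

lemma gaussian_measure_hyperplane:
  assumes "a \<noteq> 0"
  shows "emeasure (gaussian_measure mu S) {x. a \<bullet> x = c} = 0"
proof -
  have "{x. a \<bullet> x = c} \<in> null_sets lborel"
    using negligible_hyperplane[of a c] assms
    by (simp add: negligible_iff_null_sets null_sets_completion_iff closed_hyperplane borel_closed)
  then show ?thesis
    unfolding gaussian_measure_def
    by (auto simp: emeasure_density null_sets_def nn_integral_null_set)
qed

section \<open>Maxima of affine functions as networks\<close>

text \<open>ReLU units only carry nonnegative values, so a feature \<open>g j\<close> is stored
  as the pair of its positive and negative part at positions \<open>2 * j\<close> and \<open>2 * j + 1\<close>.\<close>

definition layer_carries :: "nat \<Rightarrow> (nat \<Rightarrow> real^'m::finite \<Rightarrow> real) \<Rightarrow> bool" where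
  "layer_carries n g \<longleftrightarrow> (\<exists>n0 w0 b0 Ls. \<forall>x. \<forall>j<n.
     let h = hidden_layers Ls (\<lambda>i. if i < n0 then relu (w0 i \<bullet> x + b0 i) else 0)
     in h (2 * j) = relu (g j x) \<and> h (2 * j + 1) = relu (- g j x))"

lemma relu_minus_relu: "relu t - relu (- t) = t"
  by (simp add: relu_def max_def)

lemma hidden_layers_append: "hidden_layers (Ls @ Ls') h = hidden_layers Ls' (hidden_layers Ls h)"
  by (induction Ls h rule: hidden_layers.induct) auto

lemma sum_double_nat: "(\<Sum>l<2 * n. f l) = (\<Sum>j<n. f (2 * j) + f (2 * j + 1 :: nat) :: real)"
  by (induction n) (auto simp: algebra_simps)

lemma layer_carries_affine:
  "layer_carries n (\<lambda>j x. a j \<bullet> x + c j)"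
proof -
  define w0 where "w0 i = (if even i then a (i div 2) else - a (i div 2))" for i
  define b0 where "b0 i = (if even i then c (i div 2) else - c (i div 2))" for i
  show ?thesis
    unfolding layer_carries_def
    by (rule exI[of _ "2 * n"], rule exI[of _ w0], rule exI[of _ b0], rule exI[of _ "[]"])
      (simp add: w0_def b0_def)
qed

text \<open>Since \<open>g = relu g - relu (- g)\<close>, the expression
  \<open>A * g + B * relu g\<close> has coefficient \<open>A + B\<close> on the positive part of
  \<open>g\<close> and \<open>- A\<close> on the negative part.\<close>

definition paired_weights :: "(nat \<Rightarrow> real) \<Rightarrow> (nat \<Rightarrow> real) \<Rightarrow> nat \<Rightarrow> real" where
  "paired_weights A B l = (if even l then A (l div 2) + B (l div 2) else - A (l div 2))"

lemma sum_paired_weights: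
  assumes "\<And>j. j < n \<Longrightarrow> h (2 * j) = relu (g j) \<and> h (2 * j + 1) = relu (- g j)"
  shows "(\<Sum>l<2 * n. paired_weights A B l * h l) = (\<Sum>j<n. A j * g j + B j * relu (g j))"
proof -
  have "paired_weights A B (2 * j) * h (2 * j) + paired_weights A B (2 * j + 1) * h (2 * j + 1) =
      A j * g j + B j * relu (g j)" if "j < n" for j
  proof -
    have "(A j + B j) * relu (g j) + (- A j) * relu (- g j) =
        A j * (relu (g j) - relu (- g j)) + B j * relu (g j)"
      by (simp add: algebra_simps)
    then show ?thesis
      using assms[OF that] by (simp add: paired_weights_def relu_minus_relu)
  qed
  then show ?thesis
    by (simp add: sum_double_nat)
qed

text \<open>One more hidden layer is appended. Its even units compute the new feature and its odd
  units the negated one, which is the sign \<open>sgn'\<close>; the activation then yields the two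
  parts.\<close>

lemma layer_carries_step:
  assumes "layer_carries n g"
  shows "layer_carries n' (\<lambda>k x. (\<Sum>j<n. A k j * g j x + B k j * relu (g j x)) + c k)"
proof -
  obtain n0 w0 b0 Ls where carries: "\<And>x j. j < n \<Longrightarrow>
      hidden_layers Ls (\<lambda>i. if i < n0 then relu (w0 i \<bullet> x + b0 i) else 0) (2 * j) = relu (g j x) \<and>
      hidden_layers Ls (\<lambda>i. if i < n0 then relu (w0 i \<bullet> x + b0 i) else 0) (2 * j + 1) = relu (- g j x)"
    using assms unfolding layer_carries_def Let_def by blast
  define sgn' :: "nat \<Rightarrow> real" where "sgn' i = (if even i then 1 else - 1)" for i
  define W where "W i l = sgn' i * paired_weights (A (i div 2)) (B (i div 2)) l" for i l
  define b where "b i = sgn' i * c (i div 2)" for i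
  have W: "(\<Sum>l<2 * n. W i l * hidden_layers Ls (\<lambda>i. if i < n0 then relu (w0 i \<bullet> x + b0 i) else 0) l) + b i =
      sgn' i * ((\<Sum>j<n. A (i div 2) j * g j x + B (i div 2) j * relu (g j x)) + c (i div 2))" for i x
    unfolding W_def b_def mult.assoc sum_distrib_left[symmetric] distrib_left[symmetric]
    by (subst sum_paired_weights[where g = "\<lambda>j. g j x", OF carries]) auto
  show ?thesis
    unfolding layer_carries_def
    by (rule exI[of _ n0], rule exI[of _ w0], rule exI[of _ b0],
        rule exI[of _ "Ls @ [(W, b, 2 * n, 2 * n')]"])
      (simp add: hidden_layers_append W, simp add: sgn'_def)
qed

lemma is_relu_network_readout:
  assumes "layer_carries n g"
  shows "is_relu_network (\<lambda>x. (\<Sum>j<n. A j * g j x + B j * relu (g j x)) + c)"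
proof -
  obtain n0 w0 b0 Ls where carries: "\<And>x j. j < n \<Longrightarrow>
      hidden_layers Ls (\<lambda>i. if i < n0 then relu (w0 i \<bullet> x + b0 i) else 0) (2 * j) = relu (g j x) \<and>
      hidden_layers Ls (\<lambda>i. if i < n0 then relu (w0 i \<bullet> x + b0 i) else 0) (2 * j + 1) = relu (- g j x)"
    using assms unfolding layer_carries_def Let_def by blast
  have "relu_net n0 w0 b0 Ls (2 * n) (paired_weights A B) c =
      (\<lambda>x. (\<Sum>j<n. A j * g j x + B j * relu (g j x)) + c)"
    unfolding relu_net_def Let_def
    by (intro ext) (subst sum_paired_weights[where g = "\<lambda>j. g j x" for x, OF carries], auto)
  then show ?thesis
    unfolding is_relu_network_def by metis
qed

definition max_affine :: "'a::euclidean_space set \<Rightarrow> ('a \<Rightarrow> real) \<Rightarrow> 'a \<Rightarrow> real" where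
  "max_affine Z b x = Max ((\<lambda>z. z \<bullet> x + b z) ` Z)"

text \<open>Each layer passes on all affine pieces and folds one more of them into a running
  maximum, so the depth grows with the number of pieces.\<close>

lemma is_relu_network_max_affine:
  fixes Z :: "(real^'m::finite) set"
  assumes "finite Z" "Z \<noteq> {}"
  shows "is_relu_network (max_affine Z b)"
proof -
  obtain e where e: "bij_betw e {0..<card Z} Z"
    using ex_bij_betw_nat_finite[OF assms(1)] by blast
  obtain N where N: "card Z = Suc N"
    using assms by (metis card_0_eq not0_implies_Suc)
  define l where "l j x = e j \<bullet> x + b (e j)" for j x
  define M where "M k x = Max ((\<lambda>j. l j x) ` {..k})" for k x
  \<comment> \<open>The features are the affine pieces together with the difference of the running maximum
    and the next piece, since \<open>max m l = l + relu (m - l)\<close>.\<close>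
  define g where "g k j x = (if j \<le> N then l j x else M k x - l (Suc k) x)" for k j x
  have M_Suc: "M (Suc k) x = l (Suc k) x + relu (M k x - l (Suc k) x)" for k x
  proof -
    have "M (Suc k) x = max (l (Suc k) x) (M k x)"
      by (simp add: M_def atMost_Suc)
    then show ?thesis
      by (simp add: relu_def max_def)
  qed
  \<comment> \<open>The last feature compares the running maximum with piece \<open>Suc k\<close>,
    which exists only for \<open>k < N\<close>. The comparison with the last piece is therefore
    stored at \<open>k = N - 1\<close>, and the output layer completes it.\<close>
  have carries: "layer_carries (N + 2) (g k)" if "k < N" for k
    using that
  proof (induction k)
    case 0
    define a where "a j = (if j \<le> N then e j else e 0 - e 1)" for j
    define c where "c j = (if j \<le> N then b (e j) else b (e 0) - b (e 1))" for j
    have "g 0 = (\<lambda>j x. a j \<bullet> x + c j)"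
      by (auto simp: fun_eq_iff g_def M_def l_def a_def c_def inner_diff_left)
    then show ?case
      using layer_carries_affine by simp
  next
    case (Suc k)
    \<comment> \<open>Rows up to \<open>N\<close> copy the pieces. Row \<open>Suc N\<close> forms
      \<open>l (Suc k) + relu (M k - l (Suc k)) - l (Suc (Suc k))\<close>, whose \<open>relu\<close>
      term is the activation of the previous last feature.\<close>
    define A where "A j i = (if j \<le> N then of_bool (i = j)
        else of_bool (i = Suc k) - of_bool (i = Suc (Suc k)) :: real)" for j i
    define B where "B j i = (if j \<le> N then 0 else of_bool (i = Suc N) :: real)" for j i :: nat
    have "g (Suc k) j x = (\<Sum>i<N + 2. A j i * g k i x + B j i * relu (g k i x)) + 0" if "j < N + 2" for j x
    proof (cases "j \<le> N")
      case True
      then show ?thesis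
        by (simp add: A_def B_def g_def of_bool_def if_distrib[of "\<lambda>t. t * _"] cong: if_cong)
    next
      case False
      then show ?thesis
        using Suc.prems
        by (simp add: A_def B_def g_def M_Suc sum.distrib left_diff_distrib sum_subtractf of_bool_def
            if_distrib[of "\<lambda>t. t * _"] cong: if_cong)
    qed
    then show ?case
      using layer_carries_step[OF Suc.IH, of "N + 2" A B "\<lambda>_. 0"] Suc.prems
      unfolding layer_carries_def by (simp cong: if_cong)
  qed
  have Z: "Z = e ` {..N}"
    using e N by (simp add: bij_betw_def atLeast0LessThan lessThan_Suc_atMost)
  have max: "max_affine Z b x = M N x" for x
    unfolding Z max_affine_def M_def l_def image_image ..
  show ?thesis
  proof (cases N)
    case 0
    have "max_affine Z b = (\<lambda>x. (\<Sum>j<1. 1 * (e j \<bullet> x + b (e j)) + 0 * relu (e j \<bullet> x + b (e j))) + 0)"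
      by (auto simp: fun_eq_iff max M_def l_def 0)
    then show ?thesis
      using is_relu_network_readout[OF layer_carries_affine[of 1 e "\<lambda>j. b (e j)"],
          where A = "\<lambda>_. 1" and B = "\<lambda>_. 0" and c = 0]
      by simp
  next
    case (Suc k)
    have "max_affine Z b = (\<lambda>x. (\<Sum>j<N + 2. of_bool (j = N) * g k j x + of_bool (j = Suc N) * relu (g k j x)) + 0)"
      using Suc
      by (auto simp: fun_eq_iff max M_Suc g_def sum.distrib of_bool_def if_distrib[of "\<lambda>t. t * _"] cong: if_cong)
    moreover have "is_relu_network \<dots>"
      by (rule is_relu_network_readout[OF carries]) (simp add: Suc)
    ultimately show ?thesis
      by simp
  qed
qed

section \<open>Semi-discrete transport\<close>

text \<open>These are the Laguerre cells of semi-discrete transport. The strict inequality makes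
  them open and leaves points where the maximum is attained twice outside all cells of elements of
  \<open>Z\<close>.\<close>

definition affine_cell :: "'a::euclidean_space set \<Rightarrow> ('a \<Rightarrow> real) \<Rightarrow> 'a \<Rightarrow> 'a set" where
  "affine_cell Z b z = {x. \<forall>w\<in>Z - {z}. w \<bullet> x + b w < z \<bullet> x + b z}"

lemma affine_cells_disjoint:
  assumes "z \<in> Z" "w \<in> Z" "z \<noteq> w"
  shows "affine_cell Z b z \<inter> affine_cell Z b w = {}"
proof -
  have False if "x \<in> affine_cell Z b z" "x \<in> affine_cell Z b w" for x
  proof -
    have "w \<bullet> x + b w < z \<bullet> x + b z" "z \<bullet> x + b z < w \<bullet> x + b w"
      using that assms by (auto simp: affine_cell_def)
    then show False by simp
  qed
  then show ?thesis by blast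
qed

context
  fixes Z :: "'a::euclidean_space set"
  assumes Z: "finite Z" "Z \<noteq> {}"
begin

lemma max_affine_ge: "z \<in> Z \<Longrightarrow> z \<bullet> x + b z \<le> max_affine Z b x"
  unfolding max_affine_def using Z by simp

lemma max_affine_attained: "\<exists>z\<in>Z. max_affine Z b x = z \<bullet> x + b z"
proof -
  have "Max ((\<lambda>z. z \<bullet> x + b z) ` Z) \<in> (\<lambda>z. z \<bullet> x + b z) ` Z"
    using Z by (intro Max_in) auto
  then show ?thesis
    unfolding max_affine_def by blast
qed

lemma max_affine_le_iff: "max_affine Z b x \<le> t \<longleftrightarrow> (\<forall>z\<in>Z. z \<bullet> x + b z \<le> t)"
  unfolding max_affine_def using Z by simp

lemma max_affine_lipschitz:
  assumes "\<And>z. z \<in> Z \<Longrightarrow> b z \<le> c z + e"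
  shows "max_affine Z b x \<le> max_affine Z c x + e"
  unfolding max_affine_le_iff using assms max_affine_ge[of _ x c] by (smt (verit))

lemma max_affine_shift: "max_affine Z (\<lambda>z. b z + c) x = max_affine Z b x + c"
  by (rule antisym)
    (use max_affine_lipschitz[of "\<lambda>z. b z + c" b c x] max_affine_lipschitz[of b "\<lambda>z. b z + c" "- c" x] in auto)

lemma max_affine_cong:
  assumes "\<And>z. z \<in> Z \<Longrightarrow> b z = c z"
  shows "max_affine Z b x = max_affine Z c x"
  unfolding max_affine_def using assms by (simp cong: image_cong)

lemma borel_measurable_max_affine[measurable]: "max_affine Z b \<in> borel_measurable borel"
  unfolding max_affine_def using Z by measurable

lemma open_affine_cell: "open (affine_cell Z b z)"
proof -
  have "affine_cell Z b z = (\<Inter>w\<in>Z - {z}. {x. w \<bullet> x + b w < z \<bullet> x + b z})"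
    by (auto simp: affine_cell_def)
  also have "open \<dots>"
    using Z by (intro open_INT) (auto intro!: open_Collect_less continuous_intros)
  finally show ?thesis .
qed

lemma max_affine_on_cell:
  assumes "z \<in> Z" "x \<in> affine_cell Z b z"
  shows "max_affine Z b x = z \<bullet> x + b z"
  by (rule antisym)
    (use assms max_affine_ge in \<open>auto simp: max_affine_le_iff affine_cell_def intro: less_imp_le\<close>)

text \<open>The maximum minus an active piece is minimal at \<open>x\<close>, so its derivative
  there is zero. Two active pieces with distinct slopes thus exclude differentiability.\<close>

lemma max_affine_unique_derivative:
  assumes "z \<in> Z" "max_affine Z b x = z \<bullet> x + b z" "(max_affine Z b has_derivative D) (at x)"
  shows "D = (\<lambda>h. z \<bullet> h)"
proof -
  have "((\<lambda>y. max_affine Z b y - (z \<bullet> y + b z)) has_derivative (\<lambda>h. D h - (z \<bullet> h + 0))) (at x)"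
    by (intro derivative_intros assms)
  moreover have "max_affine Z b x - (z \<bullet> x + b z) \<le> max_affine Z b y - (z \<bullet> y + b z)" for y
    using max_affine_ge[OF assms(1)] by (simp add: assms(2))
  ultimately have "(\<lambda>h. D h - (z \<bullet> h + 0)) = (\<lambda>h. 0)"
    by (intro differential_zero_maxmin[of x UNIV]) auto
  then show ?thesis
    by (simp add: fun_eq_iff)
qed

end

text \<open>The formula holds at every point: outside the cells two pieces tie, the maximum is not
  differentiable, and the default value 0 of \<open>grad\<close> agrees with a sum of vanishing
  terms.\<close>

lemma grad_max_affine:
  fixes Z :: "(real^'m::finite) set"
  assumes Z: "finite Z" "Z \<noteq> {}"
  shows "grad (max_affine Z b) x = (\<Sum>z\<in>Z. indicator (affine_cell Z b z) x *\<^sub>R z)"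
proof (cases "\<exists>z\<in>Z. x \<in> affine_cell Z b z")
  case True
  then obtain z where z: "z \<in> Z" "x \<in> affine_cell Z b z" by blast
  have "((\<lambda>y. z \<bullet> y + b z) has_derivative (\<lambda>h. z \<bullet> h)) (at x)"
    by (auto intro!: derivative_eq_intros)
  then have deriv: "(max_affine Z b has_derivative (\<lambda>h. z \<bullet> h)) (at x)"
    by (rule has_derivative_transform_within_open[OF _ open_affine_cell[OF Z] z(2)])
      (simp add: max_affine_on_cell[OF Z z(1)])
  then have "grad (max_affine Z b) x = (\<chi> i. z \<bullet> axis i 1)"
    unfolding grad_def by (auto simp: differentiable_def frechet_derivative_at[symmetric])
  also have "\<dots> = z"
    by (simp add: inner_axis vec_eq_iff)
  also have "z = (\<Sum>w\<in>Z. if w = z then w else 0)"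
    using Z z by simp
  also have "\<dots> = (\<Sum>w\<in>Z. indicator (affine_cell Z b w) x *\<^sub>R w)"
  proof (intro sum.cong refl)
    fix w assume "w \<in> Z"
    then show "(if w = z then w else 0) = indicator (affine_cell Z b w) x *\<^sub>R w"
      using z affine_cells_disjoint[of z Z w b] by (auto simp: indicator_def)
  qed
  finally show ?thesis .
next
  case False
  have "\<not> max_affine Z b differentiable (at x)"
  proof
    assume "max_affine Z b differentiable (at x)"
    then obtain D where D: "(max_affine Z b has_derivative D) (at x)"
      by (auto simp: differentiable_def)
    obtain z where z: "z \<in> Z" "max_affine Z b x = z \<bullet> x + b z"
      using max_affine_attained[OF Z] by blast
    then obtain w where w: "w \<in> Z" "w \<noteq> z" "z \<bullet> x + b z \<le> w \<bullet> x + b w"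
      using False by (force simp: affine_cell_def not_less)
    then have "max_affine Z b x = w \<bullet> x + b w"
      using max_affine_ge[OF Z w(1), of x b] z by simp
    then have "(\<lambda>h. z \<bullet> h) = (\<lambda>h. w \<bullet> h)"
      using max_affine_unique_derivative[OF Z _ _ D] z w by metis
    then have "z \<bullet> h = w \<bullet> h" for h
      by (rule fun_cong)
    then show False
      using w(2) vector_eq_rdot[of z w] by auto
  qed
  then show ?thesis
    using False by (simp add: grad_def indicator_def)
qed

text \<open>No derivative of the functional is computed. Raising a single weight at a minimiser
  already shows that each cell has mass at least \<open>p z\<close>, and comparing total masses
  turns these bounds into equalities.\<close>

lemma semidiscrete_cells:
  fixes G :: "'a::euclidean_space measure" and Z :: "'a set"
  assumes "prob_space G" and sets_G: "sets G = sets borel"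
    and hyperplane: "\<And>a c. a \<noteq> 0 \<Longrightarrow> measure G {x. a \<bullet> x = c} = 0"
    and Z: "finite Z" "Z \<noteq> {}" and p_pos: "\<And>z. z \<in> Z \<Longrightarrow> 0 < p z" and p_sum: "sum p Z = 1"
  shows "\<exists>b. \<forall>z\<in>Z. measure G (affine_cell Z b z) = p z"
proof -
  interpret prob_space G by fact
  have [measurable_cong]: "sets G = sets borel" by (rule sets_G)
  have space_G: "space G = UNIV"
    using sets_eq_imp_space_eq[OF sets_G] by simp

  \<comment> \<open>The Kantorovich functional and its continuity\<close>
  define D where "D b x = max_affine Z b x - max_affine Z (\<lambda>_. 0) x" for b x
  have D_measurable[measurable]: "D b \<in> borel_measurable borel" for b
    unfolding D_def using borel_measurable_max_affine[OF Z] by measurable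
  have D_diff: "D b x \<le> D c x + e" if "\<And>z. z \<in> Z \<Longrightarrow> b z \<le> c z + e" for b c e x
    unfolding D_def using max_affine_lipschitz[OF Z that, where x = x] by simp
  have D_0: "D (\<lambda>_. 0) x = 0" for x
    by (simp add: D_def)
  have D_int: "integrable G (D b)" for b
  proof (rule integrable_const_bound[where B = "\<Sum>z\<in>Z. \<bar>b z\<bar>"])
    have "\<bar>b z\<bar> \<le> (\<Sum>z\<in>Z. \<bar>b z\<bar>)" if "z \<in> Z" for z
      using that Z by (intro member_le_sum) auto
    then have "b z \<le> 0 + (\<Sum>z\<in>Z. \<bar>b z\<bar>)" "0 \<le> b z + (\<Sum>z\<in>Z. \<bar>b z\<bar>)" if "z \<in> Z" for z
      using that by (smt (verit))+
    then have "D b x \<le> (\<Sum>z\<in>Z. \<bar>b z\<bar>)" "0 \<le> D b x + (\<Sum>z\<in>Z. \<bar>b z\<bar>)" for x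
      using D_diff[of b "\<lambda>_. 0" "\<Sum>z\<in>Z. \<bar>b z\<bar>"] D_diff[of "\<lambda>_. 0" b "\<Sum>z\<in>Z. \<bar>b z\<bar>"]
      by (auto simp: D_0)
    then have "norm (D b x) \<le> (\<Sum>z\<in>Z. \<bar>b z\<bar>)" for x
      unfolding real_norm_def abs_le_iff by (smt (verit))
    then show "AE x in G. norm (D b x) \<le> (\<Sum>z\<in>Z. \<bar>b z\<bar>)"
      by simp
  qed measurable
  \<comment> \<open>Subtracting the maximum for zero weights makes the integrand bounded, so that \<open>G\<close> needs no moments.\<close>
  define \<Phi> where "\<Phi> b = (\<integral>x. D b x \<partial>G) - (\<Sum>z\<in>Z. p z * b z)" for b
  have \<Phi>_0: "\<Phi> (\<lambda>_. 0) = 0"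
    by (simp add: \<Phi>_def D_0)
  have int_D_diff: "(\<integral>x. D b x \<partial>G) \<le> (\<integral>x. D c x \<partial>G) + e" if "\<And>z. z \<in> Z \<Longrightarrow> b z \<le> c z + e" for b c e
  proof -
    have "(\<integral>x. D b x \<partial>G) \<le> (\<integral>x. D c x + e \<partial>G)"
      using D_int D_diff[OF that] by (intro integral_mono) auto
    also have "\<dots> = (\<integral>x. D c x \<partial>G) + e"
      using D_int by (simp add: prob_space)
    finally show ?thesis .
  qed
  have p_diff: "(\<Sum>z\<in>Z. p z * b z) \<le> (\<Sum>z\<in>Z. p z * c z) + e" if "\<And>z. z \<in> Z \<Longrightarrow> b z \<le> c z + e" for b c e
  proof -
    have "(\<Sum>z\<in>Z. p z * b z) \<le> (\<Sum>z\<in>Z. p z * (c z + e))"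
      using that p_pos by (intro sum_mono mult_left_mono) (auto intro: less_imp_le)
    also have "\<dots> = (\<Sum>z\<in>Z. p z * c z) + sum p Z * e"
      by (simp add: distrib_left sum.distrib sum_distrib_right)
    finally show ?thesis by (simp add: p_sum)
  qed
  have \<Phi>_lip: "\<bar>\<Phi> b - \<Phi> c\<bar> \<le> 2 * (\<Sum>z\<in>Z. \<bar>b z - c z\<bar>)" for b c
  proof -
    have "\<bar>b z - c z\<bar> \<le> (\<Sum>z\<in>Z. \<bar>b z - c z\<bar>)" if "z \<in> Z" for z
      using that Z by (intro member_le_sum) auto
    then have le: "b z \<le> c z + (\<Sum>z\<in>Z. \<bar>b z - c z\<bar>)" "c z \<le> b z + (\<Sum>z\<in>Z. \<bar>b z - c z\<bar>)" if "z \<in> Z" for z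
      using that by (smt (verit))+
    let ?e = "\<Sum>z\<in>Z. \<bar>b z - c z\<bar>"
    have "(\<integral>x. D b x \<partial>G) \<le> (\<integral>x. D c x \<partial>G) + ?e" "(\<integral>x. D c x \<partial>G) \<le> (\<integral>x. D b x \<partial>G) + ?e"
      by (rule int_D_diff, rule le, assumption)+
    moreover have "(\<Sum>z\<in>Z. p z * b z) \<le> (\<Sum>z\<in>Z. p z * c z) + ?e" "(\<Sum>z\<in>Z. p z * c z) \<le> (\<Sum>z\<in>Z. p z * b z) + ?e"
      by (rule p_diff, rule le, assumption)+
    ultimately show ?thesis
      unfolding \<Phi>_def by linarith
  qed
  \<comment> \<open>Continuity refers to the product topology on all functions; the Lipschitz bound
    involves only the finitely many coordinates in \<open>Z\<close>.\<close>
  have \<Phi>_cont: "continuous_on UNIV \<Phi>"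
    unfolding continuous_on_def
  proof (intro ballI)
    fix c :: "'a \<Rightarrow> real"
    have "continuous_on UNIV (\<lambda>b::'a \<Rightarrow> real. 2 * (\<Sum>z\<in>Z. \<bar>b z - c z\<bar>))"
      by (intro continuous_intros continuous_on_product_coordinates)
    then have "((\<lambda>b. 2 * (\<Sum>z\<in>Z. \<bar>b z - c z\<bar>)) \<longlongrightarrow> 2 * (\<Sum>z\<in>Z. \<bar>c z - c z\<bar>)) (at c)"
      unfolding continuous_on_def by blast
    then have "((\<lambda>b. 2 * (\<Sum>z\<in>Z. \<bar>b z - c z\<bar>)) \<longlongrightarrow> 0) (at c)"
      by (simp only: diff_self abs_zero sum.neutral_const mult_zero_right)
    then have "((\<lambda>b. \<Phi> b - \<Phi> c) \<longlongrightarrow> 0) (at c)"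
      by (rule Lim_null_comparison[rotated]) (simp add: \<Phi>_lip)
    then show "(\<Phi> \<longlongrightarrow> \<Phi> c) (at c)"
      by (simp add: Lim_null[symmetric])
  qed

  \<comment> \<open>Coercivity\<close>
  define q where "q = Min (p ` Z)"
  have q: "0 < q" "\<And>z. z \<in> Z \<Longrightarrow> q \<le> p z"
    using Z p_pos by (auto simp: q_def)
  \<comment> \<open>Outside the ball of radius \<open>R\<close> there remains mass below
    \<open>q / 2\<close>, so the loss there is at most half of the gain \<open>q * m\<close> from
    the linear term.\<close>
  have "(\<lambda>n. measure G (cball 0 (real n))) \<longlonglongrightarrow> measure G (\<Union>n. cball 0 (real n))"
    by (rule finite_Lim_measure_incseq) (auto simp: incseq_def sets_G)
  also have "(\<Union>n. cball (0::'a) (real n)) = space G"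
    using real_arch_simple by (auto simp: space_G)
  finally have "(\<lambda>n. measure G (cball 0 (real n))) \<longlonglongrightarrow> 1"
    by (simp add: prob_space)
  then have "\<forall>\<^sub>F n in sequentially. 1 - q / 2 < measure G (cball 0 (real n))"
    using q by (intro order_tendstoD(1)) auto
  then obtain R where R: "1 - q / 2 < measure G (cball 0 (real R))"
    using eventually_happens' by (metis sequentially_bot)
  define r where "r = (\<Sum>z\<in>Z. norm z)"
  have r: "norm z \<le> r" if "z \<in> Z" for z
    unfolding r_def using that Z by (intro member_le_sum) auto
  have inner_r: "\<bar>z \<bullet> x\<bar> \<le> r * real R" if "z \<in> Z" "x \<in> cball 0 (real R)" for z x
  proof -
    have "\<bar>z \<bullet> x\<bar> \<le> norm z * norm x" by (rule Cauchy_Schwarz_ineq2)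
    also have "\<dots> \<le> r * real R"
      using that r[OF that(1)] by (intro mult_mono) (auto intro: order_trans[OF norm_ge_zero])
    finally show ?thesis .
  qed
  \<comment> \<open>\<open>K\<close> is the value of \<open>m\<close> at which the lower bound
    \<open>q * m / 2 - 2 * r * real R\<close> obtained below for \<open>\<Phi> b\<close> is
    zero.\<close>
  define K where "K = 4 * r * real R / q"
  have "0 \<le> r" unfolding r_def by (simp add: sum_nonneg)
  then have "0 \<le> K" using q by (simp add: K_def)
  \<comment> \<open>Coercivity: if one of the weights is very negative, the linear term of \<open>\<Phi>\<close> beats the integral.\<close>
  have coercive: "0 \<le> \<Phi> b"
    if b0: "\<And>z. z \<in> Z \<Longrightarrow> b z \<le> 0" and z0: "z0 \<in> Z" "b z0 = 0"
      and z1: "z1 \<in> Z" "\<And>z. z \<in> Z \<Longrightarrow> b z1 \<le> b z" "b z1 \<le> - K" for b z0 z1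
  proof -
    define m where "m = - b z1"
    have "0 \<le> m" using z1(1) b0 by (simp add: m_def)
    \<comment> \<open>Inside the ball the piece \<open>z0\<close>, of weight 0, keeps the maximum
      above \<open>- r * real R\<close>. Outside, no weight is below \<open>- m\<close>, so at most
      \<open>m\<close> is lost.\<close>
    have D_lower: "- 2 * r * real R - m * indicator (- cball 0 (real R)) x \<le> D b x" for x
    proof (cases "x \<in> cball 0 (real R)")
      case True
      have "max_affine Z (\<lambda>_. 0) x \<le> r * real R"
        using inner_r[OF _ True] by (force simp: max_affine_le_iff[OF Z])
      moreover have "- (r * real R) \<le> max_affine Z b x"
        using max_affine_ge[OF Z z0(1), of x b] inner_r[OF z0(1) True] z0(2) by linarith
      ultimately show ?thesis using True by (simp add: D_def)
    next
      case False
      have "D (\<lambda>_. 0) x \<le> D b x + m"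
        by (rule D_diff) (use z1(2) in \<open>simp add: m_def\<close>)
      moreover have "0 \<le> r * real R"
        using \<open>0 \<le> r\<close> by simp
      ultimately show ?thesis using False by (simp add: D_0)
    qed
    have [measurable]: "cball 0 (real R) \<in> sets (borel :: 'a measure)" by simp
    have "measure G (- cball 0 (real R)) = 1 - measure G (cball 0 (real R))"
      using prob_compl[of "cball 0 (real R)"] by (simp add: sets_G space_G Compl_eq_Diff_UNIV)
    then have "m * measure G (- cball 0 (real R)) \<le> m * (q / 2)"
      using R \<open>0 \<le> m\<close> by (intro mult_left_mono) auto
    then have "- 2 * r * real R - m * (q / 2) \<le> - 2 * r * real R - m * measure G (- cball 0 (real R))"
      by simp
    also have "\<dots> = (\<integral>x. - 2 * r * real R - m * indicator (- cball 0 (real R)) x \<partial>G)"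
      by (subst Bochner_Integration.integral_diff)
        (auto simp: prob_space[unfolded space_G] space_G sets_G less_top[symmetric])
    also have "\<dots> \<le> (\<integral>x. D b x \<partial>G)"
      using D_lower D_int by (intro integral_mono) (auto simp: sets_G less_top[symmetric])
    finally have int: "- 2 * r * real R - m * (q / 2) \<le> (\<integral>x. D b x \<partial>G)" .
    have "(\<Sum>z\<in>Z. p z * b z) = p z1 * b z1 + (\<Sum>z\<in>Z - {z1}. p z * b z)"
      using Z z1(1) by (simp add: sum.remove)
    also have "(\<Sum>z\<in>Z - {z1}. p z * b z) \<le> 0"
      using b0 p_pos by (intro sum_nonpos mult_nonneg_nonpos) (auto intro: less_imp_le)
    also have "p z1 * b z1 \<le> - (q * m)"
      using q(2)[OF z1(1)] \<open>0 \<le> m\<close> by (auto simp: m_def mult_right_mono_neg)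
    finally have "(\<Sum>z\<in>Z. p z * b z) \<le> - (q * m)" by simp
    with int have "q * m / 2 - 2 * r * real R \<le> \<Phi> b"
      unfolding \<Phi>_def by (simp add: mult.commute)
    moreover have "q * K \<le> q * m"
      using q z1(3) by (intro mult_left_mono) (auto simp: m_def)
    ultimately show ?thesis
      using q by (simp add: K_def)
  qed

  \<comment> \<open>Existence of a minimiser\<close>
  define box where "box = PiE UNIV (\<lambda>_::'a. {- K..0})"
  \<comment> \<open>The box restricts every coordinate, also those outside \<open>Z\<close>, so
    Tychonoff makes it compact in the whole function space.\<close>
  have "compactin (product_topology (\<lambda>_. euclidean) UNIV) box"
    unfolding box_def compactin_PiE by simp
  then have "compact box"
    by (simp add: euclidean_product_topology)
  moreover have "(\<lambda>_. 0) \<in> box"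
    using \<open>0 \<le> K\<close> by (auto simp: box_def PiE_iff)
  ultimately obtain b where b: "b \<in> box" "\<And>c. c \<in> box \<Longrightarrow> \<Phi> b \<le> \<Phi> c"
    using continuous_attains_inf[of box \<Phi>] continuous_on_subset[OF \<Phi>_cont] by auto
  \<comment> \<open>As \<open>p\<close> sums to 1, \<Phi> is invariant under adding a constant on
    \<open>Z\<close>. So the largest weight may be taken to be 0, and a normalised \<open>c'\<close>
    outside the box satisfies \<open>0 \<le> \<Phi> c'\<close> by coercivity, while \<open>0\<close>
    is the value at the zero function, which lies in the box.\<close>
  have min: "\<Phi> b \<le> \<Phi> c" for c
  proof -
    have "Max (c ` Z) \<in> c ` Z"
      using Z by (intro Max_in) auto
    then obtain z0 where "z0 \<in> Z" "Max (c ` Z) = c z0"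
      by blast
    then have z0: "z0 \<in> Z" "\<And>z. z \<in> Z \<Longrightarrow> c z \<le> c z0"
      using Z Max_ge[of "c ` Z"] by auto
    define c' where "c' z = (if z \<in> Z then c z - c z0 else 0)" for z
    have "D c' x = D c x - c z0" for x
      using max_affine_shift[OF Z, of c "- c z0" x] max_affine_cong[OF Z, where b = c' and c = "\<lambda>z. c z + - c z0" and x = x]
      by (simp add: D_def c'_def Z)
    moreover have "(\<Sum>z\<in>Z. p z * c' z) = (\<Sum>z\<in>Z. p z * c z) - sum p Z * c z0"
      by (simp add: c'_def right_diff_distrib sum_subtractf sum_distrib_right)
    ultimately have "\<Phi> c' = \<Phi> c"
      using D_int by (simp add: \<Phi>_def prob_space p_sum)
    moreover have "\<Phi> b \<le> \<Phi> c'"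
    proof (cases "c' \<in> box")
      case False
      have le: "c' z \<le> 0" for z
        using z0 by (simp add: c'_def)
      define z1 where "z1 = arg_min_on c' Z"
      have z1: "z1 \<in> Z" "\<And>z. z \<in> Z \<Longrightarrow> c' z1 \<le> c' z"
        unfolding z1_def using arg_min_if_finite[OF Z, of c'] by (auto simp: not_less)
      have "c' z1 \<le> - K"
      proof (rule ccontr)
        assume "\<not> c' z1 \<le> - K"
        then have "- K \<le> c' z" for z
          using z1(2)[of z] \<open>0 \<le> K\<close> by (cases "z \<in> Z") (auto simp: c'_def)
        then show False
          using le False by (auto simp: box_def)
      qed
      then have "0 \<le> \<Phi> c'"
        using coercive[of c' z0 z1] le z0 z1 by (simp add: c'_def)
      then show ?thesis
        using b(2)[OF \<open>(\<lambda>_. 0) \<in> box\<close>] \<Phi>_0 by simp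
    qed (rule b)
    ultimately show ?thesis by simp
  qed

  \<comment> \<open>Raising \<open>b z\<close> by \<open>t\<close> changes the integral by at most \<open>t\<close> times the measure of the set below,
    so minimality bounds that measure from below.\<close>
  have near: "p z \<le> measure G {x. max_affine Z b x \<le> z \<bullet> x + b z + t}" (is "_ \<le> measure G ?A")
    if z: "z \<in> Z" and t: "0 < t" for z t
  proof -
    have [measurable]: "?A \<in> sets borel"
      using borel_measurable_max_affine[OF Z, of b] by measurable
    define c where "c = b(z := b z + t)"
    have "D c x \<le> D b x + t * indicator ?A x" for x
    proof (cases "x \<in> ?A")
      case True
      then show ?thesis
        using D_diff[of c b t x] t by (simp add: c_def)
    next
      case False
      then have "w \<bullet> x + c w \<le> max_affine Z b x" if "w \<in> Z" for w
        using max_affine_ge[OF Z that, of x b] by (auto simp: c_def)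
      then have "max_affine Z c x \<le> max_affine Z b x"
        by (simp add: max_affine_le_iff[OF Z])
      then show ?thesis using False by (simp add: D_def)
    qed
    then have "(\<integral>x. D c x \<partial>G) \<le> (\<integral>x. D b x + t * indicator ?A x \<partial>G)"
      using D_int by (intro integral_mono) (auto simp: sets_G less_top[symmetric])
    also have "\<dots> = (\<integral>x. D b x \<partial>G) + t * measure G ?A"
      using D_int by (subst Bochner_Integration.integral_add) (auto simp: sets_G space_G less_top[symmetric])
    finally have "(\<integral>x. D c x \<partial>G) \<le> (\<integral>x. D b x \<partial>G) + t * measure G ?A" .
    moreover have "(\<Sum>w\<in>Z. p w * c w) = (\<Sum>w\<in>Z. p w * b w) + t * p z"
    proof -
      have "(\<Sum>w\<in>Z. p w * c w) = (\<Sum>w\<in>Z. p w * b w + (if w = z then t * p z else 0))"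
        by (intro sum.cong) (auto simp: c_def algebra_simps)
      then show ?thesis using Z z by (simp add: sum.distrib)
    qed
    ultimately have "t * p z \<le> t * measure G ?A"
      using min[of c] by (simp add: \<Phi>_def)
    then show ?thesis using t by simp
  qed

  \<comment> \<open>Letting \<open>t\<close> run through \<open>1 / Suc n\<close>, the sets of
    near-maximality decrease to the set where piece \<open>z\<close> attains the maximum, ties
    included.\<close>
  have argmax: "p z \<le> measure G {x. max_affine Z b x \<le> z \<bullet> x + b z}" if z: "z \<in> Z" for z
  proof -
    define A where "A n = {x. max_affine Z b x \<le> z \<bullet> x + b z + 1 / Suc n}" for n
    have "range A \<subseteq> sets G"
      unfolding A_def sets_G using borel_measurable_max_affine[OF Z, of b] by auto
    moreover have "decseq A"
    proof (unfold decseq_def, intro allI impI subsetI)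
      fix m n x
      assume "m \<le> n" and x: "x \<in> A n"
      then have "1 / real (Suc n) \<le> 1 / real (Suc m)"
        by (intro divide_left_mono) auto
      then show "x \<in> A m"
        using x unfolding A_def mem_Collect_eq by linarith
    qed
    ultimately have "(\<lambda>n. measure G (A n)) \<longlonglongrightarrow> measure G (\<Inter>n. A n)"
      by (rule finite_Lim_measure_decseq)
    moreover have "(\<Inter>n. A n) = {x. max_affine Z b x \<le> z \<bullet> x + b z}"
    proof (intro set_eqI iffI)
      fix x assume "x \<in> (\<Inter>n. A n)"
      then have "max_affine Z b x - (z \<bullet> x + b z) \<le> 1 / Suc n" for n
        by (auto simp: A_def algebra_simps)
      then have "max_affine Z b x - (z \<bullet> x + b z) \<le> 0"
        by (metis linorder_not_le nat_approx_posE)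
      then show "x \<in> {x. max_affine Z b x \<le> z \<bullet> x + b z}" by simp
    qed (auto simp: A_def intro!: add_increasing2)
    ultimately show ?thesis
      using near[OF z] by (intro LIMSEQ_le_const[of "\<lambda>n. measure G (A n)"]) (auto simp: A_def)
  qed

  \<comment> \<open>From maximality sets to open cells\<close>
  have cell_sets: "affine_cell Z b z \<in> sets G" for z
    using open_affine_cell[OF Z] by (simp add: sets_G)
  have cell_ge: "p z \<le> measure G (affine_cell Z b z)" if z: "z \<in> Z" for z
  proof -
    \<comment> \<open>Passing to strict inequalities loses only ties, contained in finitely many
      hyperplanes with normal \<open>w - z \<noteq> 0\<close>.\<close>
    let ?H = "\<lambda>w. {x. (w - z) \<bullet> x = b z - b w}"
    have "{x. max_affine Z b x \<le> z \<bullet> x + b z} \<subseteq> affine_cell Z b z \<union> (\<Union>w\<in>Z - {z}. ?H w)"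
      by (force simp: max_affine_le_iff[OF Z] affine_cell_def inner_diff_left less_le)
    then have "measure G {x. max_affine Z b x \<le> z \<bullet> x + b z} \<le>
        measure G (affine_cell Z b z \<union> (\<Union>w\<in>Z - {z}. ?H w))"
      using Z cell_sets by (intro finite_measure_mono sets.Un sets.finite_UN) (auto simp: sets_G)
    also have "\<dots> \<le> measure G (affine_cell Z b z) + measure G (\<Union>w\<in>Z - {z}. ?H w)"
      using Z cell_sets by (intro measure_Un_le sets.finite_UN) (auto simp: sets_G)
    also have "measure G (\<Union>w\<in>Z - {z}. ?H w) \<le> (\<Sum>w\<in>Z - {z}. measure G (?H w))"
      using Z by (intro measure_UNION_le) (auto simp: sets_G)
    also have "\<dots> = 0"
      by (intro sum.neutral) (auto intro!: hyperplane)
    finally show ?thesis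
      using argmax[OF z] by simp
  qed
  \<comment> \<open>Disjoint cells have total mass at most 1, the sum of \<open>p\<close>;
    nonnegative excesses with sum at most 0 all vanish.\<close>
  have "(\<Sum>z\<in>Z. measure G (affine_cell Z b z)) = measure G (\<Union>z\<in>Z. affine_cell Z b z)"
    using Z cell_sets
    by (intro finite_measure_finite_Union[symmetric])
      (auto simp: disjoint_family_on_def dest: affine_cells_disjoint)
  also have "\<dots> \<le> 1" by simp
  finally have "(\<Sum>z\<in>Z. measure G (affine_cell Z b z) - p z) \<le> 0"
    by (simp add: sum_subtractf p_sum)
  moreover have nonneg: "0 \<le> measure G (affine_cell Z b z) - p z" if "z \<in> Z" for z
    using cell_ge[OF that] by simp
  ultimately have "(\<Sum>z\<in>Z. measure G (affine_cell Z b z) - p z) = 0"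
    by (intro antisym sum_nonneg) auto
  then have "\<forall>z\<in>Z. measure G (affine_cell Z b z) - p z = 0"
    using Z nonneg by (subst (asm) sum_nonneg_eq_0_iff) auto
  then show ?thesis by auto
qed

section \<open>Approximation of the target\<close>

text \<open>A case distinction on one ball at a time keeps the map Borel. The value 0 is the default
  away from all balls, hence \<open>insert 0 k\<close>.\<close>

lemma exists_nearest_assignment:
  fixes k :: "'a::euclidean_space set"
  assumes "finite k"
  shows "\<exists>T. T \<in> borel_measurable borel \<and> range T \<subseteq> insert 0 k \<and>
    (\<forall>x\<in>(\<Union>z\<in>k. ball z e). dist x (T x) < e)"
  using assms
proof (induction rule: finite_induct)
  case empty
  then show ?case by (intro exI[of _ "\<lambda>_. 0"]) auto
next
  case (insert z k)
  then obtain T where T: "T \<in> borel_measurable borel" "range T \<subseteq> insert 0 k"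
    "\<And>x. x \<in> (\<Union>z\<in>k. ball z e) \<Longrightarrow> dist x (T x) < e"
    by blast
  have "(\<lambda>x. if x \<in> ball z e then z else T x) \<in> borel_measurable borel"
    using T(1) by (intro measurable_If_set) auto
  moreover have "range (\<lambda>x. if x \<in> ball z e then z else T x) \<subseteq> insert 0 (insert z k)"
    using T(2) by auto
  ultimately show ?case
    using T(3) by (intro exI[of _ "\<lambda>x. if x \<in> ball z e then z else T x"]) (auto simp: dist_commute, blast)
qed

text \<open>A probability measure whose atoms in the finite set \<open>Z\<close> have total mass 1
  is concentrated on \<open>Z\<close>, so these atoms determine it. The equality of atoms carries
  the total over to \<open>N\<close>.\<close>

lemma prob_measure_eqI_finite_atoms:
  fixes M N :: "'a::t1_space measure"
  assumes "prob_space M" "prob_space N" and sets: "sets M = sets borel" "sets N = sets borel"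
    and Z: "finite Z" "(\<Sum>z\<in>Z. measure M {z}) = 1"
    and eq: "\<And>z. z \<in> Z \<Longrightarrow> measure M {z} = measure N {z}"
  shows "M = N"
proof -
  have atoms: "measure L A = (\<Sum>z\<in>A \<inter> Z. measure L {z})"
    if "prob_space L" and L: "sets L = sets borel" "(\<Sum>z\<in>Z. measure L {z}) = 1" and A: "A \<in> sets borel"
    for L :: "'a measure" and A
  proof -
    interpret L: prob_space L by fact
    have fin: "F \<in> sets L" if "finite F" for F
      unfolding L using that by (intro borel_closed finite_imp_closed)
    have "measure L Z = 1"
      using L.finite_measure_eq_sum_singleton[OF Z(1)] fin L(2) by simp
    then have "AE x in L. x \<in> Z"
      using L.prob_eq_1[of Z] fin Z(1) by simp
    then have "measure L A = measure L (A \<inter> Z)"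
      using A fin[of "A \<inter> Z"] Z(1) by (intro L.finite_measure_eq_AE) (auto simp: L)
    also have "\<dots> = (\<Sum>z\<in>A \<inter> Z. measure L {z})"
      using L.finite_measure_eq_sum_singleton[of "A \<inter> Z"] fin Z(1) by simp
    finally show ?thesis .
  qed
  interpret M: prob_space M by fact
  interpret N: prob_space N by fact
  show ?thesis
  proof (rule measure_eqI)
    fix A assume "A \<in> sets M"
    then have A: "A \<in> sets borel" by (simp add: sets)
    have "measure M A = (\<Sum>z\<in>A \<inter> Z. measure M {z})"
      by (rule atoms) (use assms A in auto)
    also have "\<dots> = (\<Sum>z\<in>A \<inter> Z. measure N {z})"
      using eq by (intro sum.cong) auto
    also have "\<dots> = measure N A"
      by (rule atoms[symmetric]) (use assms A in auto)
    finally have "measure M A = measure N A" .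
    then show "emeasure M A = emeasure N A"
      by (simp add: M.emeasure_eq_measure N.emeasure_eq_measure)
  qed (simp add: sets)
qed

text \<open>The joint law of \<open>x\<close> and \<open>T x\<close> is a coupling, and its cost
  bounds the infimum.\<close>

lemma wasserstein2_sq_distr_le:
  fixes P :: "'a::euclidean_space measure"
  assumes "prob_space P" and sets_P: "sets P = sets borel"
    and T: "T \<in> borel_measurable borel" and close: "AE x in P. dist x (T x) \<le> e"
  shows "wasserstein2_sq P (distr P borel T) \<le> ennreal (e\<^sup>2)"
proof -
  interpret prob_space P by fact
  have [measurable_cong]: "sets P = sets borel" by (rule sets_P)
  have [measurable]: "T \<in> borel_measurable borel" by (rule T)
  have [measurable]: "(\<lambda>x. (x, T x)) \<in> borel_measurable P" by measurable
  let ?\<gamma> = "distr P borel (\<lambda>x. (x, T x))"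
  have "distr P borel (\<lambda>x. x) = P"
    by (rule distr_id2) (simp add: sets_P)
  then have "?\<gamma> \<in> couplings P (distr P borel T)"
    unfolding couplings_def by (simp add: distr_distr comp_def borel_measurable_continuous_onI
        continuous_on_fst continuous_on_snd)
  then have "wasserstein2_sq P (distr P borel T) \<le> (\<integral>\<^sup>+z. ennreal ((norm (fst z - snd z))\<^sup>2) \<partial>?\<gamma>)"
    unfolding wasserstein2_sq_def by (rule INF_lower)
  also have "\<dots> = (\<integral>\<^sup>+x. ennreal ((norm (x - T x))\<^sup>2) \<partial>P)"
    by (subst nn_integral_distr)
      (auto intro!: borel_measurable_continuous_onI continuous_intros simp: prod.case_eq_if)
  also have "\<dots> \<le> (\<integral>\<^sup>+x. ennreal (e\<^sup>2) \<partial>P)"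
    using close
    by (intro nn_integral_mono_AE) (auto elim!: eventually_mono simp: dist_norm intro!: ennreal_leI power_mono)
  also have "\<dots> = ennreal (e\<^sup>2)"
    by (simp add: emeasure_space_1)
  finally show ?thesis .
qed

theorem theorem1:
  fixes P :: "(real^'m::finite) measure"
    and mu :: "real^'m" and S :: "real^'m^'m"
    and \<epsilon> :: real
  assumes "prob_space P"
    and "sets P = sets borel"
    and "\<exists>K. bounded K \<and> K \<in> sets borel \<and> emeasure P (UNIV - K) = 0"
    and "pos_def_matrix S"
    and "\<epsilon> > 0"
  shows "\<exists>u. is_relu_network u \<and>
           wasserstein2_sq P (distr (gaussian_measure mu S) borel (grad u)) < ennreal \<epsilon>"
proof -
  interpret P: prob_space P by fact
  let ?G = "gaussian_measure mu S"
  interpret G: prob_space ?G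
    by (rule prob_space_gaussian_measure) fact
  have sets_G: "sets ?G = sets borel"
    by (simp add: gaussian_measure_def)
  have space_P: "space P = UNIV" and space_G: "space ?G = UNIV"
    using sets_eq_imp_space_eq[OF assms(2)] sets_eq_imp_space_eq[OF sets_G] by auto
  \<comment> \<open>The transport bound below is the non-strict \<open>e\<^sup>2\<close>, so halving
    leaves room for the strict inequality.\<close>
  define e where "e = sqrt (\<epsilon> / 2)"
  have e: "0 < e" "e\<^sup>2 < \<epsilon>"
    using assms(5) by (auto simp: e_def)

  \<comment> \<open>Discretisation of the target\<close>
  obtain K where K: "bounded K" "K \<in> sets borel" "emeasure P (UNIV - K) = 0"
    using assms(3) by blast
  have "\<exists>k. finite k \<and> closure K \<subseteq> (\<Union>z\<in>k. ball z e)"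
    using compact_closure[of K] K(1) e(1) unfolding compact_eq_totally_bounded by auto
  then obtain k where k: "finite k" "K \<subseteq> (\<Union>z\<in>k. ball z e)"
    using closure_subset by blast
  obtain T where T: "T \<in> borel_measurable borel" "range T \<subseteq> insert 0 k"
    "\<And>x. x \<in> K \<Longrightarrow> dist x (T x) < e"
    using exists_nearest_assignment[OF k(1), of e] k(2) by blast
  have [measurable]: "T \<in> borel_measurable P"
    using T(1) by (simp add: measurable_cong_sets[OF assms(2) refl])
  have "AE x in P. x \<in> K"
    using K by (intro AE_I[of _ _ "UNIV - K"]) (auto simp: space_P assms(2))
  then have close: "AE x in P. dist x (T x) \<le> e"
    by eventually_elim (simp add: T(3) less_imp_le)

  let ?Q = "distr P borel T"
  interpret Q: prob_space ?Q
    by (rule P.prob_space_distr) simp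
  define p where "p z = measure ?Q {z}" for z
  \<comment> \<open>Values of mass zero are dropped because \<open>semidiscrete_cells\<close> asks
    for positive weights.\<close>
  define Z where "Z = {z \<in> insert 0 k. 0 < p z}"
  have fin: "finite Z" using k(1) by (simp add: Z_def)
  have "(\<Sum>z\<in>Z. p z) = (\<Sum>z\<in>insert 0 k. p z)"
    unfolding Z_def p_def using k(1)
    by (intro sum.mono_neutral_left) (auto simp: zero_less_measure_iff measure_le_0_iff)
  also have "\<dots> = measure ?Q (insert 0 k)"
    unfolding p_def using k(1) by (intro Q.finite_measure_eq_sum_singleton[symmetric]) auto
  also have "\<dots> = 1"
  proof -
    have "T -` insert 0 k \<inter> space P = space P"
      using T(2) by blast
    moreover have "insert 0 k \<in> sets borel"
      using k(1) by (intro borel_closed finite_imp_closed) simp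
    ultimately show ?thesis
      using P.prob_space by (subst measure_distr) auto
  qed
  finally have p_sum: "sum p Z = 1" .
  then have "Z \<noteq> {}" by auto
  obtain b where b: "\<And>z. z \<in> Z \<Longrightarrow> measure ?G (affine_cell Z b z) = p z"
    using semidiscrete_cells[OF G.prob_space_axioms sets_G _ fin \<open>Z \<noteq> {}\<close> _ p_sum]
    by (auto simp: gaussian_measure_hyperplane measure_def Z_def)

  \<comment> \<open>The law of the gradient\<close>
  let ?u = "max_affine Z b"
  have grad_eq: "grad ?u = (\<lambda>x. \<Sum>z\<in>Z. indicator (affine_cell Z b z) x *\<^sub>R z)"
    using grad_max_affine[OF fin \<open>Z \<noteq> {}\<close>] by blast
  have cell_sets: "affine_cell Z b z \<in> sets borel" for z
    using open_affine_cell[OF fin \<open>Z \<noteq> {}\<close>] by (rule borel_open)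
  have grad_meas: "grad ?u \<in> borel_measurable ?G"
    unfolding grad_eq measurable_cong_sets[OF sets_G refl]
    using cell_sets by (intro borel_measurable_sum borel_measurable_scaleR borel_measurable_indicator) auto
  let ?N = "distr ?G borel (grad ?u)"
  have N: "prob_space ?N"
    using grad_meas by (rule G.prob_space_distr)
  interpret N: prob_space ?N by (rule N)
  \<comment> \<open>Only an inequality at first: off the cells the gradient is 0, which may itself
    belong to \<open>Z\<close>. Summing over \<open>Z\<close> gives equality.\<close>
  have p_le: "p z \<le> measure ?N {z}" if z: "z \<in> Z" for z
  proof -
    have "grad ?u x = z" if x: "x \<in> affine_cell Z b z" for x
    proof -
      have "(\<Sum>w\<in>Z. indicator (affine_cell Z b w) x *\<^sub>R w) = (\<Sum>w\<in>Z. if w = z then w else 0)"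
        using affine_cells_disjoint[of _ Z z b] x z by (intro sum.cong) (auto simp: indicator_def)
      then show ?thesis
        using fin z by (simp add: grad_eq)
    qed
    then have "measure ?G (affine_cell Z b z) \<le> measure ?G (grad ?u -` {z} \<inter> space ?G)"
      using grad_meas by (intro G.finite_measure_mono measurable_sets[OF grad_meas]) (auto simp: space_G)
    then show ?thesis
      using b[OF z] grad_meas by (simp add: measure_distr)
  qed
  have "(\<Sum>z\<in>Z. measure ?N {z}) = measure ?N Z"
    using fin by (intro N.finite_measure_eq_sum_singleton[symmetric]) auto
  then have "(\<Sum>z\<in>Z. measure ?N {z} - p z) \<le> 0"
    using N.prob_le_1[of Z] by (simp add: sum_subtractf p_sum)
  then have "(\<Sum>z\<in>Z. measure ?N {z} - p z) = 0"
    using p_le by (intro antisym sum_nonneg) auto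
  then have "\<forall>z\<in>Z. measure ?N {z} - p z = 0"
    using fin p_le by (subst (asm) sum_nonneg_eq_0_iff) auto
  then have eq: "measure ?N {z} = p z" if "z \<in> Z" for z
    using that by simp
  \<comment> \<open>The gradient has exactly the discretised law, so the only transport cost is that
    of \<open>T\<close> and no triangle inequality is involved.\<close>
  have "?Q = ?N"
    using p_sum eq
    by (intro prob_measure_eqI_finite_atoms[OF Q.prob_space_axioms N _ _ fin]) (auto simp: p_def)
  then have "wasserstein2_sq P ?N \<le> ennreal (e\<^sup>2)"
    using wasserstein2_sq_distr_le[OF assms(1,2) T(1) close] by simp
  also have "\<dots> < ennreal \<epsilon>"
    using e(2) by (simp add: ennreal_less_iff)
  finally show ?thesis
    using is_relu_network_max_affine[OF fin \<open>Z \<noteq> {}\<close>, of b] by blast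
qed

end
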